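(* For positive integers $k$ and $j$, the misère outcome of the partizan Kayles position $kS_1+jS_2$ is $$o^-(kS_1+jS_2)=\begin{cases}\mathcal{N}, & \text{if } k=j, \text{ or if } k<j \text{ and } k+2j\equiv 0 \pmod 3,\\ \mathcal{R}, & \text{if } k>j, \text{ or if } k<j \text{ and } k+2j\equiv 1 \pmod 3,\\ \mathcal{P}, & \text{if } k<j \text{ and } k+2j\equiv 2\pmod 3.\end{cases}$$
   Context: Partizan Kayles is played on $1\times n$ strips of squares; $S_n$ denotes an empty strip of length $n$, and $mG$ denotes the disjunctive sum of $m$ copies of $G$. Left moves by placing a single square on one empty cell; Right moves by placing a domino covering two adjacent empty cells of the same strip. Under misère play a player unable to move on their turn wins. The outcome is $\mathcal{L}$ (Left wins moving first or second), $\mathcal{R}$ (Right wins moving first or second), $\mathcal{N}$ (the first player wins) or $\mathcal{P}$ (the second player wins). *)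

theory Defs
  imports Main "HOL-Library.FSet" "HOL-Number_Theory.Cong"
begin

datatype player = Left | Right

fun opponent :: "player \<Rightarrow> player" where
  "opponent Left = Right"
| "opponent Right = Left"

datatype game = Game (left_opts: "game fset") (right_opts: "game fset")

fun opts :: "player \<Rightarrow> game \<Rightarrow> game fset" where
  "opts Left G = left_opts G"
| "opts Right G = right_opts G"

lemma size_le_sum_fset:
  fixes H :: game
  shows "H |\<in>| A \<Longrightarrow> size H \<le> (\<Sum>x\<in>fset A. Suc (size x))"
  using member_le_sum[of H "fset A" "\<lambda>x. Suc (size x)"] by simp

lemma size_left_opts: "H |\<in>| left_opts G \<Longrightarrow> size H < size G"
  by (cases G) (auto simp: less_Suc_eq_le intro: trans_le_add1 size_le_sum_fset)

lemma size_right_opts: "H |\<in>| right_opts G \<Longrightarrow> size H < size G"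
  by (cases G) (auto simp: less_Suc_eq_le intro: trans_le_add2 size_le_sum_fset)

lemma size_opts: "H |\<in>| opts p G \<Longrightarrow> size H < size G"
  by (cases p) (auto intro: size_left_opts size_right_opts)

text \<open>Disjunctive sum: the mover moves in exactly one of the two components.\<close>

function game_sum :: "game \<Rightarrow> game \<Rightarrow> game" where
  "game_sum G H = Game
     ((\<lambda>G'. game_sum G' H) |`| left_opts G |\<union>| (\<lambda>H'. game_sum G H') |`| left_opts H)
     ((\<lambda>G'. game_sum G' H) |`| right_opts G |\<union>| (\<lambda>H'. game_sum G H') |`| right_opts H)"
  by auto
termination
  by (relation "measure (\<lambda>(G, H). size G + size H)")
    (auto dest: size_left_opts size_right_opts)

declare game_sum.simps [simp del]

instantiation game :: "{zero, plus}"
begin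

definition zero_game :: game where "0 = Game {||} {||}"

definition plus_game :: "game \<Rightarrow> game \<Rightarrow> game" where "G + H = game_sum G H"

instance ..

end

primrec copies :: "nat \<Rightarrow> game \<Rightarrow> game" where
  "copies 0 G = 0"
| "copies (Suc m) G = G + copies m G"

text \<open>Misere play: a player who is to move and has no move wins.
  \<open>misere_wins_first p G\<close> (resp. \<open>misere_wins_second p G\<close>) says that \<open>p\<close> can force
  a win in \<open>G\<close> when \<open>p\<close> (resp. the opponent of \<open>p\<close>) makes the first move.\<close>

function misere_wins_first :: "player \<Rightarrow> game \<Rightarrow> bool"
  and misere_wins_second :: "player \<Rightarrow> game \<Rightarrow> bool" where
  "misere_wins_first p G \<longleftrightarrow>
     opts p G = {||} \<or> fBex (opts p G) (misere_wins_second p)"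
| "misere_wins_second p G \<longleftrightarrow>
     opts (opponent p) G \<noteq> {||} \<and> fBall (opts (opponent p) G) (misere_wins_first p)"
  by pat_completeness auto
termination
  by (relation "measure (\<lambda>x. case x of Inl (p, G) \<Rightarrow> size G | Inr (p, G) \<Rightarrow> size G)")
    (auto dest: size_opts)

declare misere_wins_first.simps [simp del] misere_wins_second.simps [simp del]

lemma opponent_opponent [simp]: "opponent (opponent p) = p"
  by (cases p) auto

lemma misere_determined: "misere_wins_second p G \<longleftrightarrow> \<not> misere_wins_first (opponent p) G"
proof (induction G arbitrary: p rule: measure_induct_rule[of size])
  case (less G)
  have "misere_wins_first p H \<longleftrightarrow> \<not> misere_wins_second (opponent p) H"
    if "H |\<in>| opts (opponent p) G" for H
    using less[OF size_opts[OF that], of "opponent p"] by simp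
  then show ?case
    by (subst misere_wins_second.simps, subst misere_wins_first.simps) auto
qed

datatype outcome = \<L> | \<R> | \<N> | \<P>

definition misere_outcome :: "game \<Rightarrow> outcome" where
  "misere_outcome G =
     (if misere_wins_first Left G \<and> misere_wins_second Left G then \<L>
      else if misere_wins_first Right G \<and> misere_wins_second Right G then \<R>
      else if misere_wins_first Left G \<and> misere_wins_first Right G then \<N>
      else \<P>)"

lemma misere_outcome_iff:
  "misere_outcome G = \<L> \<longleftrightarrow> misere_wins_first Left G \<and> misere_wins_second Left G"
  "misere_outcome G = \<R> \<longleftrightarrow> misere_wins_first Right G \<and> misere_wins_second Right G"
  "misere_outcome G = \<N> \<longleftrightarrow> misere_wins_first Left G \<and> misere_wins_first Right G"
  "misere_outcome G = \<P> \<longleftrightarrow> misere_wins_second Left G \<and> misere_wins_second Right G"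
  by (auto simp: misere_outcome_def misere_determined)

text \<open>\<open>kayles E\<close> is partizan Kayles on a single strip whose cells are numbered by naturals
  and whose set of empty cells is \<open>E\<close>. A domino is identified with the smaller of the two
  adjacent cells it covers.\<close>

function kayles :: "nat fset \<Rightarrow> game" where
  "kayles E = Game
     ((\<lambda>c. kayles (E |-| {|c|})) |`| E)
     ((\<lambda>c. kayles (E |-| {|c, Suc c|})) |`| ffilter (\<lambda>c. Suc c |\<in>| E) E)"
  by auto
termination
  by (relation "measure fcard", simp, unfold in_measure)
    (rule pfsubset_fcard_mono, fastforce)+

declare kayles.simps [simp del]

definition strip :: "nat \<Rightarrow> game" where
  "strip n = kayles (fset_of_list [0..<n])"

end

theory Submission
  imports Defs
begin

text \<open>
  In \<open>k S\<^sub>1 + j S\<^sub>2\<close> Left either decrements \<open>k\<close> or replaces \<open>(k, j)\<close> by \<open>(k + 1, j - 1)\<close>, while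
  Right can only decrement \<open>j\<close>. One Left move followed by Right's forced reply therefore changes
  \<open>j - k\<close> by \<open>0\<close> or by \<open>-3\<close>, and Left, who wins only by being stuck on her own turn, has to
  reach \<open>(0, 0)\<close>. Hence Left wins moving first iff \<open>k \<le> j\<close> and \<open>3\<close> divides \<open>j - k\<close>, that
  is, \<open>k + 2 * j\<close>; Right wins moving first iff \<open>j = 0\<close> or Left does not win
  moving first from \<open>(k, j - 1)\<close>.
\<close>

lemma left_opts_plus:
  "left_opts (G + H) = (\<lambda>G'. G' + H) |`| left_opts G |\<union>| (\<lambda>H'. G + H') |`| left_opts H"
  unfolding plus_game_def by (subst game_sum.simps) simp

lemma right_opts_plus:
  "right_opts (G + H) = (\<lambda>G'. G' + H) |`| right_opts G |\<union>| (\<lambda>H'. G + H') |`| right_opts H"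
  unfolding plus_game_def by (subst game_sum.simps) simp

lemma left_opts_zero [simp]: "left_opts 0 = {||}"
  and right_opts_zero [simp]: "right_opts 0 = {||}"
  by (simp_all add: zero_game_def)

text \<open>Games carry sets of options, so these laws are literal equalities, proved by induction
  on size. They make moves in interchangeable summands lead to the same game.\<close>

instance game :: comm_monoid_add
proof
  fix a b c :: game
  show "a + b + c = a + (b + c)"
  proof (induction "size a + size b + size c" arbitrary: a b c rule: less_induct)
    case less
    have "x + b + c = x + (b + c)" if "x |\<in>| left_opts a \<or> x |\<in>| right_opts a" for x
      using that by (intro less) (auto dest: size_left_opts size_right_opts)
    moreover have "a + x + c = a + (x + c)" if "x |\<in>| left_opts b \<or> x |\<in>| right_opts b" for x
      using that by (intro less) (auto dest: size_left_opts size_right_opts)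
    moreover have "a + b + x = a + (b + x)" if "x |\<in>| left_opts c \<or> x |\<in>| right_opts c" for x
      using that by (intro less) (auto dest: size_left_opts size_right_opts)
    ultimately show ?case
      by (intro game.expand)
        (simp add: left_opts_plus right_opts_plus fimage_funion fset.map_comp comp_def
          funion_assoc cong: fset.map_cong)
  qed
  show "a + b = b + a"
  proof (induction "size a + size b" arbitrary: a b rule: less_induct)
    case less
    have "x + b = b + x" if "x |\<in>| left_opts a \<or> x |\<in>| right_opts a" for x
      using that by (intro less) (auto dest: size_left_opts size_right_opts)
    moreover have "a + x = x + a" if "x |\<in>| left_opts b \<or> x |\<in>| right_opts b" for x
      using that by (intro less) (auto dest: size_left_opts size_right_opts)
    ultimately show ?case
      by (intro game.expand)
        (simp add: left_opts_plus right_opts_plus funion_commute cong: fset.map_cong)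
  qed
  show "0 + a = a"
  proof (induction "size a" arbitrary: a rule: less_induct)
    case less
    have "0 + x = x" if "x |\<in>| left_opts a \<or> x |\<in>| right_opts a" for x
      using that by (intro less) (auto dest: size_left_opts size_right_opts)
    then show ?case
      by (intro game.expand) (simp add: left_opts_plus right_opts_plus cong: fset.map_cong)
  qed
qed

lemma kayles_empty: "kayles {||} = 0"
  by (subst kayles.simps) (simp add: zero_game_def)

text \<open>The cell \<open>c\<close> is arbitrary because Left's two moves in
  \<open>strip 2\<close> leave different cells; the results agree, so \<open>strip 2\<close> has one
  Left option.\<close>

lemma kayles_singleton: "kayles {|c|} = Game {|0|} {||}"
proof -
  have "ffilter (\<lambda>d. Suc d |\<in>| {|c|}) {|c|} = {||}"
    by auto
  then show ?thesis
    by (subst kayles.simps) (simp add: kayles_empty)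
qed

lemma strip_1: "strip 1 = Game {|0|} {||}"
  by (simp add: strip_def kayles_singleton)

lemma strip_2: "strip 2 = Game {|strip 1|} {|0|}"
proof -
  have "fset_of_list [0..<2] = {|0, 1|}"
    by (simp add: upt_rec numeral_2_eq_2)
  moreover have "ffilter (\<lambda>c. Suc c |\<in>| {|0, 1|}) {|0, 1|} = {|0|}"
    by auto
  moreover have "{|0, 1|} |-| {|0|} = {|1::nat|}" "{|0, 1|} |-| {|1|} = {|0::nat|}"
    "{|0, 1|} |-| {|0, Suc 0|} = {||}"
    by auto
  ultimately show ?thesis
    unfolding strip_def
    by (subst kayles.simps) (simp add: kayles_empty kayles_singleton)
qed

text \<open>By commutativity a move in any copy equals the same move in the first, so the union over
  all copies collapses to one image.\<close>

lemma left_opts_copies_Suc: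
  "left_opts (copies (Suc m) G) = (\<lambda>G'. G' + copies m G) |`| left_opts G"
proof (induction m)
  case (Suc m)
  have "left_opts (copies (Suc (Suc m)) G) =
      (\<lambda>G'. G' + copies (Suc m) G) |`| left_opts G |\<union>|
      (\<lambda>H'. G + H') |`| left_opts (copies (Suc m) G)"
    by (simp only: copies.simps(2)[of "Suc m"] left_opts_plus)
  also have "\<dots> = (\<lambda>G'. G' + copies (Suc m) G) |`| left_opts G"
    unfolding Suc by (simp add: fset.map_comp comp_def add.left_commute)
  finally show ?case .
qed (simp add: left_opts_plus)

lemma right_opts_copies_Suc:
  "right_opts (copies (Suc m) G) = (\<lambda>G'. G' + copies m G) |`| right_opts G"
proof (induction m)
  case (Suc m)
  have "right_opts (copies (Suc (Suc m)) G) =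
      (\<lambda>G'. G' + copies (Suc m) G) |`| right_opts G |\<union>|
      (\<lambda>H'. G + H') |`| right_opts (copies (Suc m) G)"
    by (simp only: copies.simps(2)[of "Suc m"] right_opts_plus)
  also have "\<dots> = (\<lambda>G'. G' + copies (Suc m) G) |`| right_opts G"
    unfolding Suc by (simp add: fset.map_comp comp_def add.left_commute)
  finally show ?case .
qed (simp add: right_opts_plus)

lemma left_opts_copies_strip_1:
  "left_opts (copies k (strip 1)) = (if k = 0 then {||} else {|copies (k - 1) (strip 1)|})"
proof -
  have "left_opts (strip 1) = {|0|}"
    by (simp add: strip_1 del: One_nat_def)
  then show ?thesis
    by (cases k) (simp_all add: left_opts_copies_Suc del: copies.simps(2) One_nat_def)
qed

lemma right_opts_copies_strip_1: "right_opts (copies k (strip 1)) = {||}"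
proof -
  have "right_opts (strip 1) = {||}"
    by (simp add: strip_1 del: One_nat_def)
  then show ?thesis
    by (cases k) (simp_all add: right_opts_copies_Suc del: copies.simps(2) One_nat_def)
qed

lemma left_opts_copies_strip_2:
  "left_opts (copies j (strip 2)) = (if j = 0 then {||} else {|strip 1 + copies (j - 1) (strip 2)|})"
proof -
  have "left_opts (strip 2) = {|strip 1|}"
    by (simp add: strip_2)
  then show ?thesis
    by (cases j) (simp_all add: left_opts_copies_Suc del: copies.simps(2))
qed

lemma right_opts_copies_strip_2:
  "right_opts (copies j (strip 2)) = (if j = 0 then {||} else {|copies (j - 1) (strip 2)|})"
proof -
  have "right_opts (strip 2) = {|0|}"
    by (simp add: strip_2)
  then show ?thesis
    by (cases j) (simp_all add: right_opts_copies_Suc del: copies.simps(2))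
qed

definition strips :: "nat \<Rightarrow> nat \<Rightarrow> game" where
  "strips k j = copies k (strip 1) + copies j (strip 2)"

lemma left_opts_strips:
  "left_opts (strips k j) =
     (if k = 0 then {||} else {|strips (k - 1) j|}) |\<union>|
     (if j = 0 then {||} else {|strips (Suc k) (j - 1)|})"
  by (simp add: strips_def left_opts_plus left_opts_copies_strip_1 left_opts_copies_strip_2 ac_simps
      del: One_nat_def)

lemma right_opts_strips:
  "right_opts (strips k j) = (if j = 0 then {||} else {|strips k (j - 1)|})"
  by (simp add: strips_def right_opts_plus right_opts_copies_strip_1 right_opts_copies_strip_2
      del: One_nat_def)

lemma right_wins_first_strips:
  "misere_wins_first Right (strips k j) \<longleftrightarrow> j = 0 \<or> \<not> misere_wins_first Left (strips k (j - 1))"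
  by (subst misere_wins_first.simps) (simp add: right_opts_strips misere_determined)

text \<open>This unfolds a Left move and Right's only reply. Without a reply Right is stuck and
  wins; hence \<open>j > 0\<close> after a move in \<open>strip 1\<close>, but \<open>j > 1\<close>
  after a move in \<open>strip 2\<close>, which itself uses up one such strip.\<close>

lemma left_wins_first_strips_rec:
  "misere_wins_first Left (strips k j) \<longleftrightarrow>
     k = 0 \<and> j = 0 \<or>
     k > 0 \<and> j > 0 \<and> misere_wins_first Left (strips (k - 1) (j - 1)) \<or>
     j > 1 \<and> misere_wins_first Left (strips (Suc k) (j - 2))"
  by (subst misere_wins_first.simps)
    (auto simp: left_opts_strips misere_determined right_wins_first_strips numeral_2_eq_2)

lemma left_wins_first_strips:
  "misere_wins_first Left (strips k j) \<longleftrightarrow> k \<le> j \<and> [k + 2 * j = 0] (mod 3)"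
\<comment> \<open>\<open>k\<close> varies because a Left move in \<open>strip 2\<close> raises it,
  while \<open>j\<close> drops in both exchanges.\<close>
proof (induction j arbitrary: k rule: less_induct)
  case (less j)
  \<comment> \<open>Both exchanges lower \<open>k + 2 * j\<close> by 3 and keep its residue; only
    the bound relating \<open>k\<close> and \<open>j\<close> can change.\<close>
  have "misere_wins_first Left (strips (k - 1) (j - 1)) \<longleftrightarrow> k \<le> j \<and> (k + 2 * j) mod 3 = 0"
    if "k > 0" "j > 0"
  proof -
    obtain k' j' where "k = Suc k'" "j = Suc j'"
      using \<open>k > 0\<close> \<open>j > 0\<close> by (metis gr0_implies_Suc)
    then show ?thesis
      using less[of j' k'] by (simp add: cong_def)
  qed
  moreover have "misere_wins_first Left (strips (Suc k) (j - 2)) \<longleftrightarrow>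
      k + 3 \<le> j \<and> (k + 2 * j) mod 3 = 0" if "j > 1"
  proof -
    obtain i where "j = i + 2"
      using \<open>j > 1\<close> by (metis add.commute less_imp_Suc_add one_add_one plus_1_eq_Suc add_Suc_right)
    then show ?thesis
      using less[of i "Suc k"] by (simp add: cong_def) presburger
  qed
  \<comment> \<open>If \<open>k > 0\<close>, then \<open>k \<le> j\<close> gives
    \<open>j > 0\<close> and the first exchange works. If \<open>k = 0\<close>, the congruence makes
    \<open>j\<close> a multiple of 3, so \<open>j\<close> is 0 or at least 3.\<close>
  moreover have "k = 0 \<and> j = 0 \<or> k > 0 \<and> j > 0 \<and> k \<le> j \<and> (k + 2 * j) mod 3 = 0 \<or>
      j > 1 \<and> k + 3 \<le> j \<and> (k + 2 * j) mod 3 = 0 \<longleftrightarrow> k \<le> j \<and> (k + 2 * j) mod 3 = 0"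
    by presburger
  ultimately show ?case
    using left_wins_first_strips_rec[of k j] unfolding cong_def mod_0 by argo
qed

theorem theorem4p1:
  fixes k j :: nat
  assumes "k > 0" and "j > 0"
  shows "(k = j \<or> k < j \<and> [k + 2 * j = 0] (mod 3) \<longrightarrow>
            misere_outcome (copies k (strip 1) + copies j (strip 2)) = \<N>) \<and>
         (k > j \<or> k < j \<and> [k + 2 * j = 1] (mod 3) \<longrightarrow>
            misere_outcome (copies k (strip 1) + copies j (strip 2)) = \<R>) \<and>
         (k < j \<and> [k + 2 * j = 2] (mod 3) \<longrightarrow>
            misere_outcome (copies k (strip 1) + copies j (strip 2)) = \<P>)"
proof -
  obtain i where j: "j = Suc i"
    using \<open>j > 0\<close> gr0_implies_Suc by blast
  \<comment> \<open>Right must move to \<open>strips k i\<close>, where \<open>k \<le> i\<close>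
    means \<open>k < j\<close> and \<open>k + 2 * i\<close> is 2 less than
    \<open>k + 2 * j\<close>.\<close>
  have "misere_wins_first Right (strips k j) \<longleftrightarrow> \<not> (k < j \<and> [k + 2 * j = 2] (mod 3))"
    by (simp add: j right_wins_first_strips left_wins_first_strips cong_def) presburger
  moreover have "[k + 2 * j = 0] (mod 3)" if "k = j"
    using that by (simp add: cong_def)
  ultimately show ?thesis
    \<comment> \<open>By determinacy, who wins moving first, for each player, fixes the
      outcome.\<close>
    unfolding strips_def[symmetric] misere_outcome_iff misere_determined opponent.simps
      left_wins_first_strips
    by (auto simp: cong_def)
qed

end
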